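(* There is an absolute constant $c>0$ such that for any $\epsilon>0$, if $\gamma\leq c\,\frac{\epsilon^2}{\log(n/\epsilon)}$, then with probability at least $1-\epsilon$ the Hypothetical-Oblivious-Conservative algorithm consumes at most $c_i$ units of every resource $i$ and obtains total type-$i$ profit at least $W_{E}(1-2\epsilon)$ for every $i$ (i.e. achieves objective value $W_{E}(1-2\epsilon)$).
   Context: Online resource allocation problem: $n\geq 2$ resources indexed by $i$, resource $i$ having capacity $c_i>0$. Each request $j$ can be served by one option $k$ from a finite set $\mathcal{K}$ or dropped; option $k$ for request $j$ consumes $a_{ijk}\geq 0$ of resource $i$ and yields type-$i$ profit $w_{ijk}\geq0$. $m$ requests arrive one by one, drawn i.i.d. from a distribution over request types $j\in\mathcal{J}$ with probabilities $p_j$, and each is irrevocably served or dropped on arrival. The objective is $\min_i$(total type-$i$ profit) subject to consumption of resource $i$ being at most $c_i$. The expected-instance LP: maximize $\lambda$ s.t. $\sum_{j,k}mp_jw_{ijk}x_{jk}\geq\lambda$ and $\sum_{j,k}mp_ja_{ijk}x_{jk}\leq c_i$ for all $i$, $\sum_k x_{jk}\leq1$ for all $j$, $x\geq0$; $W_{E}$ is its optimal value and $x^*_{jk}$ an optimal solution. $\gamma=\max(\{a_{ijk}/c_i\}\cup\{w_{ijk}/W_{E}\})$. The Hypothetical-Oblivious-Conservative algorithm (which knows the distribution) serves each arriving request $j$ with option $k$ with probability $x^*_{jk}/(1+\epsilon)$, independently, and drops it with the remaining probability. *)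

theory Defs
  imports "HOL-Probability.Probability"
begin

text \<open>
  Resources, request types and options are all indexed by natural numbers, so that a constant
  chosen before the instance cannot depend on index types. The set of request types need not be
  finite; a distribution given by point probabilities \<open>p\<^sub>j\<close> has countable support in any case.
\<close>

record alloc_instance =
  nres :: nat
  cap :: "nat \<Rightarrow> real"
  rtypes :: "nat set"
  choices :: "nat set"
  consume :: "nat \<Rightarrow> nat \<Rightarrow> nat \<Rightarrow> real"
  profit :: "nat \<Rightarrow> nat \<Rightarrow> nat \<Rightarrow> real"
  rdist :: "nat pmf"
  nreq :: nat

definition valid_instance :: "alloc_instance \<Rightarrow> bool" where
  "valid_instance I \<longleftrightarrow>
     nres I \<ge> 2 \<and>
     (\<forall>i<nres I. cap I i > 0) \<and>
     finite (choices I) \<and>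
     set_pmf (rdist I) \<subseteq> rtypes I \<and>
     (\<forall>i<nres I. \<forall>j\<in>rtypes I. \<forall>k\<in>choices I. consume I i j k \<ge> 0 \<and> profit I i j k \<ge> 0)"

text \<open>
  The sums over request types are sums of nonnegative terms; when there are infinitely many types,
  convergence is required explicitly because \<^const>\<open>infsum\<close> is \<open>0\<close> on divergent families.
\<close>

definition LP_feasible :: "alloc_instance \<Rightarrow> (nat \<Rightarrow> nat \<Rightarrow> real) \<Rightarrow> real \<Rightarrow> bool" where
  "LP_feasible I x lam \<longleftrightarrow>
     (\<forall>i<nres I.
        (\<lambda>j. \<Sum>k\<in>choices I. nreq I * pmf (rdist I) j * profit I i j k * x j k)
          summable_on rtypes I \<and>
        (\<Sum>\<^sub>\<infinity>j\<in>rtypes I. \<Sum>k\<in>choices I. nreq I * pmf (rdist I) j * profit I i j k * x j k)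
          \<ge> lam) \<and>
     (\<forall>i<nres I.
        (\<lambda>j. \<Sum>k\<in>choices I. nreq I * pmf (rdist I) j * consume I i j k * x j k)
          summable_on rtypes I \<and>
        (\<Sum>\<^sub>\<infinity>j\<in>rtypes I. \<Sum>k\<in>choices I. nreq I * pmf (rdist I) j * consume I i j k * x j k)
          \<le> cap I i) \<and>
     (\<forall>j\<in>rtypes I. (\<Sum>k\<in>choices I. x j k) \<le> 1) \<and>
     (\<forall>j\<in>rtypes I. \<forall>k\<in>choices I. x j k \<ge> 0)"

definition LP_optimal :: "alloc_instance \<Rightarrow> (nat \<Rightarrow> nat \<Rightarrow> real) \<Rightarrow> real \<Rightarrow> bool" where
  "LP_optimal I x W \<longleftrightarrow>
     LP_feasible I x W \<and> (\<forall>y lam. LP_feasible I y lam \<longrightarrow> lam \<le> W)"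

text \<open>
  The supremum is a maximum when there are finitely many request types. It is taken in the extended
  reals so that unbounded ratios give \<open>\<infinity>\<close>; extended-real division makes the ratio \<open>w / 0\<close>
  equal to \<open>\<infinity>\<close> for \<open>w > 0\<close> and to \<open>0\<close> for \<open>w = 0\<close>.
\<close>

definition gamma_param :: "alloc_instance \<Rightarrow> real \<Rightarrow> ereal" where
  "gamma_param I W =
     Sup ({ereal (consume I i j k) / ereal (cap I i) | i j k.
             i < nres I \<and> j \<in> rtypes I \<and> k \<in> choices I} \<union>
          {ereal (profit I i j k) / ereal W | i j k.
             i < nres I \<and> j \<in> rtypes I \<and> k \<in> choices I})"

text \<open>\<^const>\<open>None\<close> means that the request is dropped.\<close>

definition hoc_decision ::
  "alloc_instance \<Rightarrow> (nat \<Rightarrow> nat \<Rightarrow> real) \<Rightarrow> real \<Rightarrow> nat \<Rightarrow> nat option pmf" where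
  "hoc_decision I x \<epsilon> j = embed_pmf (\<lambda>d. case d of
       None \<Rightarrow> 1 - (\<Sum>k\<in>choices I. x j k / (1 + \<epsilon>))
     | Some k \<Rightarrow> if k \<in> choices I then x j k / (1 + \<epsilon>) else 0)"

lemma pmf_hoc_decision:
  assumes "finite (choices I)" "\<epsilon> > 0"
    and "\<And>k. k \<in> choices I \<Longrightarrow> x j k \<ge> 0" "(\<Sum>k\<in>choices I. x j k) \<le> 1"
  shows "pmf (hoc_decision I x \<epsilon> j) d = (case d of
       None \<Rightarrow> 1 - (\<Sum>k\<in>choices I. x j k / (1 + \<epsilon>))
     | Some k \<Rightarrow> if k \<in> choices I then x j k / (1 + \<epsilon>) else 0)"
proof -
  let ?f = "\<lambda>d. case d of
       None \<Rightarrow> 1 - (\<Sum>k\<in>choices I. x j k / (1 + \<epsilon>))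
     | Some k \<Rightarrow> if k \<in> choices I then x j k / (1 + \<epsilon>) else 0"
  let ?A = "insert None (Some ` choices I)"
  have "(\<Sum>k\<in>choices I. x j k / (1 + \<epsilon>)) \<le> 1"
    using assms(2,4) by (simp add: sum_divide_distrib[symmetric])
  then have nonneg: "0 \<le> ?f d" for d
    using assms(2,3) by (auto split: option.split)
  have "?f d = 0" if "d \<notin> ?A" for d
    using that by (cases d) auto
  then have "(\<integral>\<^sup>+d. ennreal (?f d) \<partial>count_space UNIV) = (\<Sum>d\<in>?A. ennreal (?f d))"
    using assms(1) by (intro nn_integral_count_space') auto
  also have "\<dots> = ennreal (\<Sum>d\<in>?A. ?f d)"
    using nonneg by (intro sum_ennreal) auto
  also have "(\<Sum>d\<in>?A. ?f d) = 1"
    using assms(1) by (simp add: sum.reindex image_iff)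
  finally have "(\<integral>\<^sup>+d. ennreal (?f d) \<partial>count_space UNIV) = 1" by simp
  with nonneg show ?thesis
    unfolding hoc_decision_def by (intro pmf_embed_pmf) auto
qed

text \<open>
  An outcome assigns to each arrival time \<open>t < m\<close> the arriving request type and the decision made.
\<close>

definition hoc_run ::
  "alloc_instance \<Rightarrow> (nat \<Rightarrow> nat \<Rightarrow> real) \<Rightarrow> real \<Rightarrow> (nat \<Rightarrow> nat \<times> nat option) pmf" where
  "hoc_run I x \<epsilon> = Pi_pmf {..<nreq I} (0, None)
     (\<lambda>_. do {j \<leftarrow> rdist I; d \<leftarrow> hoc_decision I x \<epsilon> j; return_pmf (j, d)})"

definition total :: "nat \<Rightarrow> (nat \<Rightarrow> nat \<Rightarrow> real) \<Rightarrow> (nat \<Rightarrow> nat \<times> nat option) \<Rightarrow> real" where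
  "total m v \<omega> = (\<Sum>t<m. case \<omega> t of (j, None) \<Rightarrow> 0 | (j, Some k) \<Rightarrow> v j k)"

definition total_consumption :: "alloc_instance \<Rightarrow> nat \<Rightarrow> (nat \<Rightarrow> nat \<times> nat option) \<Rightarrow> real" where
  "total_consumption I i = total (nreq I) (consume I i)"

definition total_profit :: "alloc_instance \<Rightarrow> nat \<Rightarrow> (nat \<Rightarrow> nat \<times> nat option) \<Rightarrow> real" where
  "total_profit I i = total (nreq I) (profit I i)"

end

theory Submission
  imports Defs
begin

text \<open>
  Scaling the LP solution by \<open>1 / (1 + \<epsilon>)\<close> makes the expected consumption of resource \<open>i\<close> at most
  \<open>c\<^sub>i / (1 + \<epsilon>)\<close> and the expected type-\<open>i\<close> profit at least \<open>W / (1 + \<epsilon>)\<close>. Both totals are sums of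
  \<open>m\<close> i.i.d. nonnegative terms, each at most \<open>\<gamma> c\<^sub>i\<close> respectively \<open>\<gamma> W\<close>, so Chernoff's bound with
  exponent \<open>\<plusminus>\<epsilon>/2\<close> shows that each of the \<open>2 n\<close> bad events has probability at most
  \<open>exp (- \<epsilon>\<^sup>2 / (8 \<gamma>))\<close>. For \<open>\<gamma> \<le> \<epsilon>\<^sup>2 / (16 ln (n / \<epsilon>))\<close> this is at most \<open>(\<epsilon> / n)\<^sup>2 \<le> \<epsilon> / (2 n)\<close>,
  and a union bound finishes the proof.
\<close>

section \<open>Exponential inequalities and Chernoff's bound for i.i.d. sums\<close>

text \<open>Convexity: on the segment from 0 to \<open>s\<close> the graph of \<open>exp\<close>
  lies below its chord. The right side is linear in \<open>y\<close>, so after taking expectations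
  only the mean of a variable in [0,1] matters.\<close>

lemma exp_mult_le_chord:
  fixes s y :: real
  assumes "0 \<le> y" "y \<le> 1"
  shows "exp (s * y) \<le> 1 + y * (exp s - 1)"
proof -
  have "exp ((1 - y) *\<^sub>R 0 + y *\<^sub>R s) \<le> (1 - y) * exp 0 + y * exp s"
    using assms by (intro convex_onD[OF exp_convex]) auto
  then show ?thesis by (simp add: algebra_simps)
qed

lemma exp_le_one_plus_plus_square:
  fixes s :: real
  assumes "\<bar>s\<bar> \<le> 1"
  shows "exp s \<le> 1 + s + s\<^sup>2"
proof (cases "0 \<le> s")
  case True
  then show ?thesis using exp_bound[of s] assms by simp
next
  case False
  define t where "t = - s"
  have t: "0 < t" using False by (simp add: t_def)
  have "exp s = 1 / exp t" by (simp add: t_def exp_minus field_simps)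
  \<comment> \<open>The quadratic bound \<open>exp_bound\<close> covers nonnegative arguments only,
    so a negative exponent goes through the reciprocal.\<close>
  also have "\<dots> \<le> 1 / (1 + t)"
    using t exp_ge_add_one_self[of t] by (intro divide_left_mono) auto
  also have "\<dots> \<le> 1 - t + t\<^sup>2"
  proof -
    have "(1 - t + t\<^sup>2) * (1 + t) = 1 + t ^ 3"
      by (simp add: algebra_simps power2_eq_square power3_eq_cube)
    then show ?thesis using t by (simp add: pos_divide_le_eq)
  qed
  finally show ?thesis by (simp add: t_def)
qed

text \<open>Markov's inequality for the exponential of \<open>s\<close> times the sum: independence
  turns the expectation of the product into a power, and each factor is bounded by the chord
  inequality followed by \<open>1 + z \<le> exp z\<close>. The sign of \<open>s\<close> is left
  free, so that one statement serves both tails.\<close>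

lemma Chernoff_Pi_pmf:
  fixes f :: "'a \<Rightarrow> real" and s b :: real
  assumes fin: "finite A" and range: "\<And>y. y \<in> set_pmf p \<Longrightarrow> 0 \<le> f y \<and> f y \<le> 1"
  shows "measure_pmf.prob (Pi_pmf A dflt (\<lambda>_. p)) {\<omega>. b \<le> s * (\<Sum>t\<in>A. f (\<omega> t))}
         \<le> exp (card A * measure_pmf.expectation p f * (exp s - 1) - b)"
proof -
  let ?P = "Pi_pmf A dflt (\<lambda>_. p)"
  let ?u = "\<lambda>\<omega>. \<Prod>t\<in>A. exp (s * f (\<omega> t))"
  have u: "?u \<omega> = exp (s * (\<Sum>t\<in>A. f (\<omega> t)))" for \<omega>
    using fin by (simp add: exp_sum sum_distrib_left)
  have bnd: "exp (s * f y) \<le> exp \<bar>s\<bar>" if "y \<in> set_pmf p" for y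
  proof -
    have "s * f y \<le> \<bar>s\<bar> * f y" using range[OF that] by (intro mult_right_mono) auto
    also have "\<dots> \<le> \<bar>s\<bar>" using range[OF that] by (intro mult_left_le) auto
    finally show ?thesis by simp
  qed
  have int_f: "integrable (measure_pmf p) f"
    using range by (intro measure_pmf.integrable_const_bound[where B = 1]) (auto simp: AE_measure_pmf_iff)
  have int_exp: "integrable (measure_pmf p) (\<lambda>y. exp (s * f y))"
    using bnd by (intro measure_pmf.integrable_const_bound[where B = "exp \<bar>s\<bar>"])
      (auto simp: AE_measure_pmf_iff)
  have int_u: "integrable (measure_pmf ?P) ?u"
  proof (intro measure_pmf.integrable_const_bound[where B = "exp \<bar>s\<bar> ^ card A"])
    have "?u \<omega> \<le> exp \<bar>s\<bar> ^ card A" if "\<omega> \<in> set_pmf ?P" for \<omega>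
    proof -
      have "\<omega> t \<in> set_pmf p" if "t \<in> A" for t
        using \<open>\<omega> \<in> set_pmf ?P\<close> that fin by (auto simp: set_Pi_pmf PiE_dflt_def)
      then have "?u \<omega> \<le> (\<Prod>t\<in>A. exp \<bar>s\<bar>)"
        using bnd by (intro prod_mono) auto
      then show ?thesis by simp
    qed
    then show "AE \<omega> in measure_pmf ?P. norm (?u \<omega>) \<le> exp \<bar>s\<bar> ^ card A"
      by (auto simp: AE_measure_pmf_iff abs_of_nonneg prod_nonneg)
  qed auto
  have one: "measure_pmf.expectation p (\<lambda>y. exp (s * f y))
             \<le> exp (measure_pmf.expectation p f * (exp s - 1))"
  proof -
    have "measure_pmf.expectation p (\<lambda>y. exp (s * f y))
          \<le> measure_pmf.expectation p (\<lambda>y. 1 + f y * (exp s - 1))"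
      using range int_f int_exp
      by (intro integral_mono_AE) (auto simp: AE_measure_pmf_iff intro!: exp_mult_le_chord)
    also have "\<dots> = 1 + measure_pmf.expectation p f * (exp s - 1)"
      using int_f by (subst Bochner_Integration.integral_add) auto
    also have "\<dots> \<le> exp (measure_pmf.expectation p f * (exp s - 1))"
      by (rule exp_ge_add_one_self)
    finally show ?thesis .
  qed
  have "measure_pmf.prob ?P {\<omega>. b \<le> s * (\<Sum>t\<in>A. f (\<omega> t))}
        = measure_pmf.prob ?P {\<omega> \<in> space (measure_pmf ?P). exp b \<le> ?u \<omega>}"
    unfolding u by simp
  also have "\<dots> \<le> measure_pmf.expectation ?P ?u / exp b"
    using int_u by (intro integral_Markov_inequality_measure[where A = UNIV]) (auto simp: prod_nonneg)
  also have "measure_pmf.expectation ?P ?u = measure_pmf.expectation p (\<lambda>y. exp (s * f y)) ^ card A"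
    using fin int_exp by (subst expectation_prod_Pi_pmf) auto
  also have "\<dots> / exp b \<le> exp (measure_pmf.expectation p f * (exp s - 1)) ^ card A / exp b"
    using one by (intro divide_right_mono power_mono) (auto intro!: integral_nonneg_AE)
  also have "\<dots> = exp (card A * measure_pmf.expectation p f * (exp s - 1) - b)"
    by (simp add: exp_diff exp_of_nat_mult[symmetric] mult.assoc)
  finally show ?thesis .
qed

section \<open>Expected value of a single arrival\<close>

text \<open>Brings expectations into the form of the LP sums, which range over all of
  \<open>rtypes\<close>; types outside the support have weight 0.\<close>

lemma expectation_pmf_eq_infsum:
  fixes h :: "'a \<Rightarrow> real"
  assumes "integrable (measure_pmf p) h" and "set_pmf p \<subseteq> A"
  shows "measure_pmf.expectation p h = (\<Sum>\<^sub>\<infinity>x\<in>A. pmf p x * h x)"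
proof -
  have "integrable (count_space UNIV) (\<lambda>x. pmf p x * h x)"
    using assms(1) unfolding measure_pmf_eq_density by (subst (asm) integrable_density) auto
  then have "measure_pmf.expectation p h = (\<Sum>\<^sub>\<infinity>x. pmf p x * h x)"
    by (simp add: pmf_expectation_eq_infsetsum infsetsum_infsum abs_summable_on_def)
  also have "\<dots> = (\<Sum>\<^sub>\<infinity>x\<in>A. pmf p x * h x)"
    using assms(2) by (intro infsum_cong_neutral) (auto simp: pmf_eq_0_set_pmf)
  finally show ?thesis .
qed

definition hoc_step ::
  "alloc_instance \<Rightarrow> (nat \<Rightarrow> nat \<Rightarrow> real) \<Rightarrow> real \<Rightarrow> (nat \<times> nat option) pmf" where
  "hoc_step I x \<epsilon> = do {j \<leftarrow> rdist I; d \<leftarrow> hoc_decision I x \<epsilon> j; return_pmf (j, d)}"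

definition step_value :: "(nat \<Rightarrow> nat \<Rightarrow> real) \<Rightarrow> nat \<times> nat option \<Rightarrow> real" where
  "step_value v y = (case y of (j, None) \<Rightarrow> 0 | (j, Some k) \<Rightarrow> v j k)"

lemma step_value_simps [simp]:
  "step_value v (j, None) = 0" "step_value v (j, Some k) = v j k"
  by (simp_all add: step_value_def)

lemma hoc_run_eq: "hoc_run I x \<epsilon> = Pi_pmf {..<nreq I} (0, None) (\<lambda>_. hoc_step I x \<epsilon>)"
  by (simp add: hoc_run_def hoc_step_def)

lemma total_eq: "total m v \<omega> = (\<Sum>t<m. step_value v (\<omega> t))"
  by (simp add: total_def step_value_def)

text \<open>Only those LP constraints that make the decision probabilities well defined are
  collected here. The capacity and profit rows enter later, as bounds on means.\<close>

locale hoc =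
  fixes I :: alloc_instance and x :: "nat \<Rightarrow> nat \<Rightarrow> real" and \<epsilon> :: real
  assumes fin: "finite (choices I)"
    and supp: "set_pmf (rdist I) \<subseteq> rtypes I"
    and eps: "\<epsilon> > 0"
    and x_nonneg: "\<And>j k. j \<in> rtypes I \<Longrightarrow> k \<in> choices I \<Longrightarrow> 0 \<le> x j k"
    and x_le: "\<And>j. j \<in> rtypes I \<Longrightarrow> (\<Sum>k\<in>choices I. x j k) \<le> 1"
begin

lemma pmf_decision:
  assumes "j \<in> rtypes I"
  shows "pmf (hoc_decision I x \<epsilon> j) d = (case d of
       None \<Rightarrow> 1 - (\<Sum>k\<in>choices I. x j k / (1 + \<epsilon>))
     | Some k \<Rightarrow> if k \<in> choices I then x j k / (1 + \<epsilon>) else 0)"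
  using assms by (intro pmf_hoc_decision fin eps x_nonneg x_le)

lemma set_pmf_decision:
  assumes "j \<in> rtypes I"
  shows "set_pmf (hoc_decision I x \<epsilon> j) \<subseteq> insert None (Some ` choices I)"
proof
  fix d assume d: "d \<in> set_pmf (hoc_decision I x \<epsilon> j)"
  show "d \<in> insert None (Some ` choices I)"
  proof (cases d)
    case (Some k)
    then show ?thesis
      using d pmf_decision[OF assms, of d] by (auto simp: set_pmf_iff split: if_splits)
  qed simp
qed

text \<open>Signs and bounds of consumption and profit are known only on \<open>rtypes\<close> and
  \<open>choices\<close>; this rule makes them available almost surely.\<close>

lemma set_pmf_stepE:
  assumes "y \<in> set_pmf (hoc_step I x \<epsilon>)"
  obtains j where "j \<in> rtypes I" "y = (j, None)"
  | j k where "j \<in> rtypes I" "k \<in> choices I" "y = (j, Some k)"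
proof -
  obtain j d where "j \<in> set_pmf (rdist I)" "d \<in> set_pmf (hoc_decision I x \<epsilon> j)" "y = (j, d)"
    using assms by (auto simp: hoc_step_def)
  then show ?thesis using supp set_pmf_decision[of j] that by blast
qed

lemma expectation_decision:
  assumes "j \<in> rtypes I"
  shows "measure_pmf.expectation (hoc_decision I x \<epsilon> j) (\<lambda>d. step_value v (j, d))
         = (\<Sum>k\<in>choices I. v j k * x j k) / (1 + \<epsilon>)"
proof -
  have "measure_pmf.expectation (hoc_decision I x \<epsilon> j) (\<lambda>d. step_value v (j, d))
        = (\<Sum>d\<in>insert None (Some ` choices I).
             step_value v (j, d) * pmf (hoc_decision I x \<epsilon> j) d)"
    using fin set_pmf_decision[OF assms] by (intro integral_measure_pmf_real) auto
  also have "\<dots> = (\<Sum>k\<in>choices I. v j k * (x j k / (1 + \<epsilon>)))"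
    using fin assms by (simp add: sum.reindex image_iff pmf_decision)
  finally show ?thesis by (simp add: sum_divide_distrib)
qed

text \<open>The link between algorithm and LP: averaging first over the decision and then over the
  type turns the expected total of \<open>v\<close> into the corresponding LP row, scaled by
  \<open>1 / (1 + \<epsilon>)\<close>. The bound \<open>B\<close> provides integrability over
  possibly infinitely many types.\<close>

lemma expectation_step:
  assumes v: "\<And>j k. j \<in> rtypes I \<Longrightarrow> k \<in> choices I \<Longrightarrow> 0 \<le> v j k \<and> v j k \<le> B"
    and B: "0 \<le> B"
  shows "nreq I * measure_pmf.expectation (hoc_step I x \<epsilon>) (step_value v)
         = (\<Sum>\<^sub>\<infinity>j\<in>rtypes I. \<Sum>k\<in>choices I. nreq I * pmf (rdist I) j * v j k * x j k) / (1 + \<epsilon>)"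
proof -
  define h where "h j = (\<Sum>k\<in>choices I. v j k * x j k) / (1 + \<epsilon>)" for j
  have h_nonneg: "0 \<le> h j" if "j \<in> rtypes I" for j
    using that v x_nonneg eps by (auto simp: h_def intro!: divide_nonneg_nonneg sum_nonneg)
  have h_le: "h j \<le> B" if "j \<in> rtypes I" for j
  proof -
    have "(\<Sum>k\<in>choices I. v j k * x j k) \<le> (\<Sum>k\<in>choices I. B * x j k)"
      using that v x_nonneg by (intro sum_mono mult_right_mono) auto
    also have "\<dots> = B * (\<Sum>k\<in>choices I. x j k)" by (simp add: sum_distrib_left)
    also have "\<dots> \<le> B" using x_le[OF that] B by (intro mult_left_le)
    also have "\<dots> \<le> B * (1 + \<epsilon>)" using eps B by (simp add: algebra_simps)
    finally show ?thesis using eps by (simp add: h_def pos_divide_le_eq)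
  qed
  have int_h: "integrable (measure_pmf (rdist I)) h"
    using h_nonneg h_le supp
    by (intro measure_pmf.integrable_const_bound[where B = B]) (auto simp: AE_measure_pmf_iff)
  have inner: "(\<integral>\<^sup>+d. ennreal (step_value v (j, d)) \<partial>hoc_decision I x \<epsilon> j) = ennreal (h j)"
    if j: "j \<in> rtypes I" for j
  proof -
    have "finite (set_pmf (hoc_decision I x \<epsilon> j))"
      using set_pmf_decision[OF j] fin by (meson finite.insertI finite_imageI finite_subset)
    moreover have "0 \<le> step_value v (j, d)" if "d \<in> set_pmf (hoc_decision I x \<epsilon> j)" for d
      using that set_pmf_decision[OF j] v[OF j] by auto
    ultimately show ?thesis
      unfolding h_def expectation_decision[OF j, symmetric]
      by (intro nn_integral_eq_integral integrable_measure_pmf_finite) (auto simp: AE_measure_pmf_iff)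
  qed
  \<comment> \<open>For nonnegative integrals the bind splits into an iterated integral without any
    integrability condition; the return to real expectations comes afterwards.\<close>
  have "(\<integral>\<^sup>+y. ennreal (step_value v y) \<partial>hoc_step I x \<epsilon>)
        = (\<integral>\<^sup>+j. \<integral>\<^sup>+d. ennreal (step_value v (j, d)) \<partial>hoc_decision I x \<epsilon> j \<partial>rdist I)"
    by (simp add: hoc_step_def)
  also have "\<dots> = (\<integral>\<^sup>+j. ennreal (h j) \<partial>rdist I)"
    using supp inner by (intro nn_integral_cong_AE) (auto simp: AE_measure_pmf_iff)
  also have "\<dots> = ennreal (measure_pmf.expectation (rdist I) h)"
    using int_h h_nonneg supp by (intro nn_integral_eq_integral) (auto simp: AE_measure_pmf_iff)
  finally have nn: "(\<integral>\<^sup>+y. ennreal (step_value v y) \<partial>hoc_step I x \<epsilon>)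
                    = ennreal (measure_pmf.expectation (rdist I) h)" .
  have "measure_pmf.expectation (hoc_step I x \<epsilon>) (step_value v)
        = enn2real (\<integral>\<^sup>+y. ennreal (step_value v y) \<partial>hoc_step I x \<epsilon>)"
    using v by (intro integral_eq_nn_integral) (auto simp: AE_measure_pmf_iff elim!: set_pmf_stepE)
  also have "\<dots> = measure_pmf.expectation (rdist I) h"
    unfolding nn using h_nonneg supp
    by (intro enn2real_ennreal integral_nonneg_AE) (auto simp: AE_measure_pmf_iff)
  also have "\<dots> = (\<Sum>\<^sub>\<infinity>j\<in>rtypes I. pmf (rdist I) j * h j)"
    using int_h supp by (rule expectation_pmf_eq_infsum)
  finally have "nreq I * measure_pmf.expectation (hoc_step I x \<epsilon>) (step_value v)
      = (\<Sum>\<^sub>\<infinity>j\<in>rtypes I. nreq I * (pmf (rdist I) j * h j))"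
    by (simp add: infsum_cmult_right')
  \<comment> \<open>As a left factor, the scaling leaves the infinite sum by
    \<open>infsum_cmult_right'\<close>, which asks for no summability.\<close>
  also have "\<dots> = (\<Sum>\<^sub>\<infinity>j\<in>rtypes I. inverse (1 + \<epsilon>) *
                   (\<Sum>k\<in>choices I. nreq I * pmf (rdist I) j * v j k * x j k))"
    by (intro infsum_cong) (simp add: h_def sum_distrib_left sum_divide_distrib field_simps)
  also have "\<dots> = inverse (1 + \<epsilon>) *
      (\<Sum>\<^sub>\<infinity>j\<in>rtypes I. \<Sum>k\<in>choices I. nreq I * pmf (rdist I) j * v j k * x j k)"
    by (rule infsum_cmult_right')
  finally show ?thesis by (simp add: field_simps)
qed

section \<open>Tail bounds for total consumption and total profit\<close>

text \<open>Dividing each term by \<open>B\<close> puts it into [0,1]; the Chernoff parameter of the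
  rescaled sum is then \<open>s * B\<close>.\<close>

lemma Chernoff_total:
  assumes v: "\<And>j k. j \<in> rtypes I \<Longrightarrow> k \<in> choices I \<Longrightarrow> 0 \<le> v j k \<and> v j k \<le> B"
    and B: "0 < B"
  shows "measure_pmf.prob (hoc_run I x \<epsilon>) {\<omega>. b \<le> s * total (nreq I) v \<omega>}
         \<le> exp ((\<Sum>\<^sub>\<infinity>j\<in>rtypes I. \<Sum>k\<in>choices I. nreq I * pmf (rdist I) j * v j k * x j k)
                  / (1 + \<epsilon>) * (exp (s * B) - 1) / B - b)"
proof -
  let ?f = "\<lambda>y. step_value v y / B"
  have range: "0 \<le> ?f y \<and> ?f y \<le> 1" if "y \<in> set_pmf (hoc_step I x \<epsilon>)" for y
    using that by (rule set_pmf_stepE) (use v B in auto)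
  have eq: "s * total (nreq I) v \<omega> = s * B * (\<Sum>t<nreq I. ?f (\<omega> t))" for \<omega>
    using B by (simp add: total_eq sum_divide_distrib[symmetric])
  have "measure_pmf.prob (hoc_run I x \<epsilon>) {\<omega>. b \<le> s * total (nreq I) v \<omega>}
        \<le> exp (card {..<nreq I} * measure_pmf.expectation (hoc_step I x \<epsilon>) ?f
                 * (exp (s * B) - 1) - b)"
    unfolding eq hoc_run_eq using range by (intro Chernoff_Pi_pmf) auto
  also have "card {..<nreq I} * measure_pmf.expectation (hoc_step I x \<epsilon>) ?f
      = nreq I * measure_pmf.expectation (hoc_step I x \<epsilon>) (step_value v) / B"
    by simp
  also have "\<dots> = (\<Sum>\<^sub>\<infinity>j\<in>rtypes I. \<Sum>k\<in>choices I. nreq I * pmf (rdist I) j * v j k * x j k)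
      / (1 + \<epsilon>) / B"
    using v B by (subst expectation_step[where B = B]) auto
  finally show ?thesis by (simp add: mult_ac)
qed

lemma prob_total_gt:
  assumes v: "\<And>j k. j \<in> rtypes I \<Longrightarrow> k \<in> choices I \<Longrightarrow> 0 \<le> v j k \<and> v j k \<le> g * c"
    and pos: "0 < g" "0 < c" and e1: "\<epsilon> \<le> 1"
    and mean: "(\<Sum>\<^sub>\<infinity>j\<in>rtypes I. \<Sum>k\<in>choices I. nreq I * pmf (rdist I) j * v j k * x j k) \<le> c"
  shows "measure_pmf.prob (hoc_run I x \<epsilon>) {\<omega>. c < total (nreq I) v \<omega>} \<le> exp (- \<epsilon>\<^sup>2 / (8 * g))"
proof -
  define M where "M = (\<Sum>\<^sub>\<infinity>j\<in>rtypes I. \<Sum>k\<in>choices I. nreq I * pmf (rdist I) j * v j k * x j k)"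
  define B where "B = g * c"
  \<comment> \<open>Chosen so that the rescaled parameter \<open>s * B\<close> is
    \<open>\<epsilon> / 2\<close>, which is at most 1 and thus within reach of the quadratic bound
    on \<open>exp\<close>.\<close>
  define s where "s = \<epsilon> / 2 / B"
  have B: "0 < B" using pos by (simp add: B_def)
  have s: "s * B = \<epsilon> / 2" "s * c = \<epsilon> / 2 / g" "0 < s"
    using B pos eps by (auto simp: s_def B_def)
  have "measure_pmf.prob (hoc_run I x \<epsilon>) {\<omega>. c < total (nreq I) v \<omega>}
        \<le> measure_pmf.prob (hoc_run I x \<epsilon>) {\<omega>. s * c \<le> s * total (nreq I) v \<omega>}"
    using s(3) by (intro measure_pmf.finite_measure_mono) auto
  also have "\<dots> \<le> exp (M / (1 + \<epsilon>) * (exp (s * B) - 1) / B - s * c)"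
    unfolding M_def using v B by (intro Chernoff_total) (auto simp: B_def)
  also have "M / (1 + \<epsilon>) * (exp (s * B) - 1) / B - s * c \<le> - \<epsilon>\<^sup>2 / (8 * g)"
  proof -
    have "M * (exp (s * B) - 1) \<le> c * (\<epsilon> / 2 + (\<epsilon> / 2)\<^sup>2)"
      unfolding s using mean pos eps e1 exp_le_one_plus_plus_square[of "\<epsilon> / 2"]
      by (intro mult_mono) (auto simp: M_def)
    then have "M * (exp (s * B) - 1) / ((1 + \<epsilon>) * B) \<le> c * (\<epsilon> / 2 + (\<epsilon> / 2)\<^sup>2) / ((1 + \<epsilon>) * B)"
      using eps B by (intro divide_right_mono) auto
    also have "\<dots> = \<epsilon> / 2 / g - \<epsilon>\<^sup>2 / (4 * (1 + \<epsilon>) * g)"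
      using eps pos by (simp add: B_def divide_simps) (simp add: power2_eq_square algebra_simps)
    \<comment> \<open>Here \<open>1 + \<epsilon> \<le> 2\<close> doubles the constant 4 to 8. The
      first term is exactly \<open>s * c\<close>, which the Chernoff exponent subtracts.\<close>
    also have "\<dots> \<le> \<epsilon> / 2 / g - \<epsilon>\<^sup>2 / (8 * g)"
      using eps e1 pos by (intro diff_left_mono divide_left_mono) auto
    finally show ?thesis by (simp add: s)
  qed
  finally show ?thesis by simp
qed

text \<open>The mirror image with negative \<open>s\<close>: multiplying by \<open>s\<close> turns
  the lower tail into an upper one, and \<open>exp (s * B) - 1\<close> is negative, so a lower bound
  on the mean is what bounds the exponent. The mean is only known to reach
  \<open>c / (1 + \<epsilon>)\<close>, which is at least \<open>c * (1 - \<epsilon>)\<close>; the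
  target \<open>c * (1 - 2 * \<epsilon>)\<close> leaves the room for deviation.\<close>

lemma prob_total_lt:
  assumes v: "\<And>j k. j \<in> rtypes I \<Longrightarrow> k \<in> choices I \<Longrightarrow> 0 \<le> v j k \<and> v j k \<le> g * c"
    and pos: "0 < g" "0 < c" and e1: "\<epsilon> \<le> 1"
    and mean: "(\<Sum>\<^sub>\<infinity>j\<in>rtypes I. \<Sum>k\<in>choices I. nreq I * pmf (rdist I) j * v j k * x j k) \<ge> c"
  shows "measure_pmf.prob (hoc_run I x \<epsilon>) {\<omega>. total (nreq I) v \<omega> < c * (1 - 2 * \<epsilon>)}
         \<le> exp (- \<epsilon>\<^sup>2 / (8 * g))"
proof -
  define M where "M = (\<Sum>\<^sub>\<infinity>j\<in>rtypes I. \<Sum>k\<in>choices I. nreq I * pmf (rdist I) j * v j k * x j k)"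
  define B where "B = g * c"
  define s where "s = - (\<epsilon> / 2 / B)"
  have B: "0 < B" using pos by (simp add: B_def)
  have s: "s * B = - (\<epsilon> / 2)" "s * (c * (1 - 2 * \<epsilon>)) = - (\<epsilon> / 2 * (1 - 2 * \<epsilon>) / g)" "s < 0"
    using B pos eps by (auto simp: s_def B_def)
  have "measure_pmf.prob (hoc_run I x \<epsilon>) {\<omega>. total (nreq I) v \<omega> < c * (1 - 2 * \<epsilon>)}
        \<le> measure_pmf.prob (hoc_run I x \<epsilon>) {\<omega>. s * (c * (1 - 2 * \<epsilon>)) \<le> s * total (nreq I) v \<omega>}"
    using s(3) by (intro measure_pmf.finite_measure_mono) (auto intro: mult_left_mono_neg)
  also have "\<dots> \<le> exp (M / (1 + \<epsilon>) * (exp (s * B) - 1) / B - s * (c * (1 - 2 * \<epsilon>)))"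
    unfolding M_def using v B by (intro Chernoff_total) (auto simp: B_def)
  also have "M / (1 + \<epsilon>) * (exp (s * B) - 1) / B - s * (c * (1 - 2 * \<epsilon>)) \<le> - \<epsilon>\<^sup>2 / (8 * g)"
  proof -
    have "M * (exp (s * B) - 1) \<le> c * (exp (s * B) - 1)"
      unfolding s using mean eps by (intro mult_right_mono_neg) (auto simp: M_def)
    also have "\<dots> \<le> c * (- (\<epsilon> / 2) + (\<epsilon> / 2)\<^sup>2)"
      unfolding s using pos eps e1 exp_le_one_plus_plus_square[of "- (\<epsilon> / 2)"]
      by (intro mult_left_mono) auto
    finally have "M * (exp (s * B) - 1) / ((1 + \<epsilon>) * B)
        \<le> c * (- (\<epsilon> / 2) + (\<epsilon> / 2)\<^sup>2) / ((1 + \<epsilon>) * B)"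
      using eps B by (intro divide_right_mono) auto
    also have "\<dots> = - (\<epsilon> / 2 * (1 - 2 * \<epsilon>) / g) - (\<epsilon>\<^sup>2 + 4 * \<epsilon> ^ 3) / (4 * (1 + \<epsilon>) * g)"
      using eps pos by (simp add: B_def divide_simps)
        (simp add: power2_eq_square power3_eq_cube algebra_simps)
    \<comment> \<open>The positive cubic term is dropped and \<open>1 + \<epsilon>\<close> is
      replaced by 2.\<close>
    also have "\<dots> \<le> - (\<epsilon> / 2 * (1 - 2 * \<epsilon>) / g) - \<epsilon>\<^sup>2 / (8 * g)"
      using eps e1 pos by (intro diff_left_mono frac_le) auto
    finally show ?thesis by (simp add: s)
  qed
  finally show ?thesis by simp
qed

end

section \<open>Consequences of optimality and of the bound on gamma\<close>

text \<open>Dropping every request is feasible with objective 0.\<close>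

lemma LP_optimal_nonneg:
  assumes "valid_instance I" "LP_optimal I x W"
  shows "0 \<le> W"
proof -
  have "LP_feasible I (\<lambda>_ _. 0) 0"
    using assms(1) by (auto simp: LP_feasible_def valid_instance_def less_imp_le)
  then show ?thesis using assms(2) by (simp add: LP_optimal_def)
qed

lemma gamma_param_consume_le:
  assumes "gamma_param I W \<le> ereal g" "i < nres I" "j \<in> rtypes I" "k \<in> choices I" "0 < cap I i"
  shows "consume I i j k \<le> g * cap I i"
proof -
  have "ereal (consume I i j k) / ereal (cap I i) \<le> gamma_param I W"
    unfolding gamma_param_def using assms(2-4) by (intro Sup_upper) blast
  then have "ereal (consume I i j k / cap I i) \<le> ereal g"
    using assms(1,5) order_trans by fastforce
  then show ?thesis using assms(5) by (simp add: pos_divide_le_eq)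
qed

text \<open>With \<open>0 < W\<close> the extended-real quotient is an ordinary one and can be
  multiplied out; the case \<open>W = 0\<close> is treated separately in the theorem.\<close>

lemma gamma_param_profit_le:
  assumes "gamma_param I W \<le> ereal g" "i < nres I" "j \<in> rtypes I" "k \<in> choices I" "0 < W"
  shows "profit I i j k \<le> g * W"
proof -
  have "ereal (profit I i j k) / ereal W \<le> gamma_param I W"
    unfolding gamma_param_def using assms(2-4) by (intro Sup_upper) blast
  then have "ereal (profit I i j k / W) \<le> ereal g"
    using assms(1,5) order_trans by fastforce
  then show ?thesis using assms(5) by (simp add: pos_divide_le_eq)
qed

section \<open>Choice of the constant and union bound\<close>

theorem theorem5:
  "\<exists>C::real. C > 0 \<and>
     (\<forall>(I::alloc_instance) (xstar::nat \<Rightarrow> nat \<Rightarrow> real) (W::real) (\<epsilon>::real).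
        valid_instance I \<longrightarrow> LP_optimal I xstar W \<longrightarrow> \<epsilon> > 0 \<longrightarrow>
        gamma_param I W \<le> ereal (C * (\<epsilon>\<^sup>2 / ln (real (nres I) / \<epsilon>))) \<longrightarrow>
        measure_pmf.prob (hoc_run I xstar \<epsilon>)
          {\<omega>. \<forall>i<nres I. total_consumption I i \<omega> \<le> cap I i \<and>
                          total_profit I i \<omega> \<ge> W * (1 - 2 * \<epsilon>)} \<ge> 1 - \<epsilon>)"
proof (intro exI[of _ "1 / 16 :: real"] conjI allI impI)
  fix I x W and \<epsilon> :: real
  assume valid: "valid_instance I" and opt: "LP_optimal I x W" and eps: "\<epsilon> > 0"
    and gamma: "gamma_param I W \<le> ereal (1 / 16 * (\<epsilon>\<^sup>2 / ln (real (nres I) / \<epsilon>)))"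
  let ?P = "hoc_run I x \<epsilon>"
  let ?good = "{\<omega>. \<forall>i<nres I. total_consumption I i \<omega> \<le> cap I i \<and>
                          total_profit I i \<omega> \<ge> W * (1 - 2 * \<epsilon>)}"
  show "measure_pmf.prob ?P ?good \<ge> 1 - \<epsilon>"
  \<comment> \<open>For \<open>\<epsilon> \<ge> 1\<close> the claimed probability is at most 0.
    Otherwise \<open>n / \<epsilon> > 1\<close>, so the logarithm is positive.\<close>
  proof (cases "\<epsilon> < 1")
    case False
    then have "1 - \<epsilon> \<le> 0" by simp
    also have "0 \<le> measure_pmf.prob ?P ?good" by simp
    finally show ?thesis .
  next
    case e1: True
    define n where "n = real (nres I)"
    \<comment> \<open>The upper bound \<open>g\<close> stands in for \<open>gamma_param\<close>,
      which need not be a positive real; the tail bounds divide by \<open>g\<close>.\<close>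
    define g where "g = 1 / 16 * (\<epsilon>\<^sup>2 / ln (n / \<epsilon>))"
    define \<delta> where "\<delta> = exp (- \<epsilon>\<^sup>2 / (8 * g))"
    have n: "2 \<le> n" using valid by (simp add: n_def valid_instance_def)
    have "1 < n / \<epsilon>" using n eps e1 by (simp add: less_divide_eq)
    then have L: "0 < ln (n / \<epsilon>)" by simp
    have g: "0 < g" using L eps by (simp add: g_def)
    have \<delta>: "2 * n * \<delta> \<le> \<epsilon>"
    proof -
      \<comment> \<open>The constant 16 is twice the 8 of the tail bounds, which yields the square
        of \<open>\<epsilon> / n\<close>. One factor pays for the number of resources; the other is
        at most 1/2 and pays for the two bad events per resource.\<close>
      have "- \<epsilon>\<^sup>2 / (8 * g) = - (2 * ln (n / \<epsilon>))" using eps L by (simp add: g_def)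
      then have "\<delta> = (\<epsilon> / n)\<^sup>2"
        using n eps unfolding \<delta>_def
        by (simp add: exp_minus exp_double power2_eq_square)
      then have "2 * n * \<delta> = \<epsilon> * (2 * \<epsilon> / n)"
        using n by (simp add: power2_eq_square)
      also have "\<dots> \<le> \<epsilon>"
        using n eps e1 by (intro mult_left_le) (auto simp: pos_divide_le_eq)
      finally show ?thesis .
    qed
    have gamma': "gamma_param I W \<le> ereal g" using gamma by (simp add: g_def n_def)
    have feas: "LP_feasible I x W" using opt by (simp add: LP_optimal_def)
    interpret hoc I x \<epsilon>
      using valid feas eps by unfold_locales (auto simp: valid_instance_def LP_feasible_def)
    have W: "0 \<le> W" using valid opt by (rule LP_optimal_nonneg)
    define over where "over i = {\<omega>. cap I i < total_consumption I i \<omega>}" for i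
    define short where "short i = {\<omega>. total_profit I i \<omega> < W * (1 - 2 * \<epsilon>)}" for i
    have over: "measure_pmf.prob ?P (over i) \<le> \<delta>" if i: "i < nres I" for i
    proof -
      have c: "0 < cap I i" using valid i by (simp add: valid_instance_def)
      show ?thesis
        unfolding over_def total_consumption_def \<delta>_def
        using i c valid feas e1 g gamma_param_consume_le[OF gamma' i _ _ c]
        by (intro prob_total_gt) (auto simp: valid_instance_def LP_feasible_def)
    qed
    have short: "measure_pmf.prob ?P (short i) \<le> \<delta>" if i: "i < nres I" for i
    proof (cases "W = 0")
      case False
      then have W': "0 < W" using W by simp
      show ?thesis
        unfolding short_def total_profit_def \<delta>_def
        using i W' valid feas e1 g gamma_param_profit_le[OF gamma' i _ _ W']
        by (intro prob_total_lt) (auto simp: valid_instance_def LP_feasible_def)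
    next
      case True
      \<comment> \<open>When \<open>W = 0\<close> the target profit is 0, and no Chernoff bound is
        needed: profits are nonnegative on the support of the run, where all types and options are
        admissible.\<close>
      have "\<omega> \<notin> short i" if \<omega>: "\<omega> \<in> set_pmf ?P" for \<omega>
      proof -
        have "\<omega> t \<in> set_pmf (hoc_step I x \<epsilon>)" if "t < nreq I" for t
          using \<omega> that by (auto simp: hoc_run_eq set_Pi_pmf PiE_dflt_def)
        moreover have "0 \<le> step_value (profit I i) y" if "y \<in> set_pmf (hoc_step I x \<epsilon>)" for y
          using that by (rule set_pmf_stepE) (use valid i in \<open>auto simp: valid_instance_def\<close>)
        ultimately have "0 \<le> step_value (profit I i) (\<omega> t)" if "t < nreq I" for t
          using that by blast
        then have "0 \<le> total_profit I i \<omega>"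
          by (auto simp: total_profit_def total_eq intro!: sum_nonneg)
        then show ?thesis using True by (simp add: short_def)
      qed
      then have "measure_pmf.prob ?P (short i) = 0"
        by (auto simp: measure_pmf_zero_iff)
      then show ?thesis by (simp add: \<delta>_def)
    qed
    have "1 - measure_pmf.prob ?P ?good = measure_pmf.prob ?P (- ?good)"
      using measure_pmf.prob_compl[of ?good ?P] by (simp add: Compl_eq_Diff_UNIV)
    also have "- ?good = (\<Union>i<nres I. over i \<union> short i)"
      by (auto simp: over_def short_def not_le)
    also have "measure_pmf.prob ?P \<dots> \<le> (\<Sum>i<nres I. measure_pmf.prob ?P (over i \<union> short i))"
      by (intro measure_pmf.finite_measure_subadditive_finite) auto
    also have "\<dots> \<le> (\<Sum>i<nres I. 2 * \<delta>)"
    proof (intro sum_mono)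
      fix i assume "i \<in> {..<nres I}"
      then show "measure_pmf.prob ?P (over i \<union> short i) \<le> 2 * \<delta>"
        using over[of i] short[of i] measure_Un_le[of "over i" "measure_pmf ?P" "short i"]
        by simp
    qed
    also have "\<dots> \<le> \<epsilon>" using \<delta> by (simp add: n_def mult_ac)
    finally show ?thesis by simp
  qed
qed simp

end
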